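(* Let $q$ be a prime power, let $F$ be a field containing $\mathbb{F}_q$, let $d\ge 1$ and $1\le s<q$ be integers, and let $\mu, b_1,\dots,b_d\in F$, $M_j\in F$ ($1\le j\le s$) and $B_{ij}\in F$ ($1\le i\le d$, $1\le j\le s$). Assume $\mu+\sum_{i=1}^d\theta_ib_i\neq 0$ for all $\theta=(\theta_1,\dots,\theta_d)\in\mathbb{F}_q^d$. Then $$\prod_{j=1}^s\ \sum_{\theta\in \mathbb{F}_q^d}\frac{M_j+\sum_{i=1}^d \theta_iB_{ij}}{\mu+\sum_{i=1}^d\theta_ib_i} =\Big(\sum_{\theta\in\mathbb{F}_q^d} \frac{1}{\mu+\sum_{i=1}^d\theta_ib_i}\Big)^{s-1} \sum_{\theta\in\mathbb{F}_q^d} \frac{\prod_{j=1}^s \big(M_j+\sum_{i=1}^d\theta_iB_{ij}\big)}{\mu+\sum_{i=1}^d \theta_ib_i}.$$ *)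

theory Defs
  imports Complex_Main "HOL-Library.FuncSet" "HOL-Number_Theory.Prime_Powers"
    "HOL-Algebra.Algebraic_Closure_Type"
begin

end

theory Submission
  imports Defs
begin

text \<open>Suppose the \<open>b\<^sub>i\<close> are independent over \<open>K\<close>, with span \<open>V\<close> of size \<open>q\<^sup>d\<close>. The product of
  \<open>X - w\<close> over the span of all \<open>b\<^sub>j\<close> except \<open>b\<^sub>i\<close> is a \<open>K\<close>-linear polynomial of degree
  \<open>q\<^sup>d\<^sup>-\<^sup>1\<close>, so up to a scalar it is the \<open>i\<close>-th coordinate function on \<open>V\<close>. Hence each
  numerator is a polynomial \<open>g\<^sub>j\<close> of degree at most \<open>q\<^sup>d\<^sup>-\<^sup>1\<close> in \<open>v = \<Sum>\<theta>\<^sub>i b\<^sub>i\<close>, and a product of fewer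
  than \<open>q\<close> of them has degree below \<open>q\<^sup>d\<close>. For \<open>g\<close> of such degree, Lagrange interpolation on \<open>V\<close>
  gives \<open>\<Sum> g(v) / (\<mu> + v) = C g(-\<mu>)\<close> with \<open>C\<close> independent of \<open>g\<close>, so both sides equal
  \<open>C\<^sup>s \<Prod> g\<^sub>j(-\<mu>)\<close>. If the \<open>b\<^sub>i\<close> are dependent and \<open>s > 1\<close>, then \<open>q > 2\<close> and both sides vanish.\<close>

section \<open>Interpolation on a finite additive subgroup\<close>

lemma lagrange_interpolation:
  fixes g :: "'a :: field poly"
  assumes "finite V" and "Polynomial.degree g < card V"
  shows "poly g x = (\<Sum>v\<in>V. poly g v * (\<Prod>w\<in>V - {v}. (x - w) / (v - w)))"
proof -
  define L where "L v = (\<Prod>w\<in>V - {v}. Polynomial.smult (1 / (v - w)) [:- w, 1:])" for v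
  define h where "h = (\<Sum>v\<in>V. Polynomial.smult (poly g v) (L v))"
  have poly_L: "poly (L v) y = (\<Prod>w\<in>V - {v}. (y - w) / (v - w))" for v y
    by (simp add: L_def poly_prod diff_divide_distrib)
  have "Polynomial.degree (L v) \<le> card V - 1" if "v \<in> V" for v
  proof -
    have "Polynomial.degree (Polynomial.smult c [:a, 1:]) \<le> 1" for a c :: 'a
      by (rule order_trans[OF degree_smult_le]) simp
    hence "Polynomial.degree (L v) \<le> (\<Sum>w\<in>V - {v}. 1)"
      unfolding L_def using assms(1)
      by (intro order_trans[OF degree_prod_sum_le] sum_mono) (auto simp only: o_apply)
    with that assms show ?thesis by simp
  qed
  hence "Polynomial.degree h \<le> card V - 1"
    unfolding h_def
    by (intro degree_sum_le) (use assms in \<open>auto intro: order_trans[OF degree_smult_le]\<close>)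
  hence "Polynomial.degree h < card V" using assms by linarith
  moreover have "poly g y = poly h y" if "y \<in> V" for y
  proof -
    have "poly h y = (\<Sum>v\<in>V. if v = y then poly g y else 0)"
      unfolding h_def poly_sum poly_smult poly_L using assms(1) that
      by (intro sum.cong) (auto intro!: prod.neutral prod_zero)
    with that assms show ?thesis by simp
  qed
  ultimately have "g = h" using poly_eqI_degree assms(2) by metis
  hence "poly g x = poly h x" by simp
  thus ?thesis by (simp add: h_def poly_sum poly_L)
qed

text \<open>On a finite additive subgroup, the denominators of the Lagrange basis polynomials
  all equal the product of the nonzero elements.\<close>

lemma partial_fraction_additive_subgroup:
  fixes V :: "'a :: field set"
  assumes "finite V" and diff: "\<And>v w. v \<in> V \<Longrightarrow> w \<in> V \<Longrightarrow> v - w \<in> V"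
    and nz: "\<And>v. v \<in> V \<Longrightarrow> x + v \<noteq> 0"
  shows "\<exists>C. \<forall>g. Polynomial.degree g < card V \<longrightarrow>
           (\<Sum>v\<in>V. poly g v / (x + v)) = C * poly g (- x)"
proof -
  define D where "D = \<Prod>(V - {0})"
  define P where "P = (\<Prod>w\<in>V. - x - w)"
  \<comment> \<open>The reflection \<open>u \<mapsto> v - u\<close> of \<open>V\<close> exchanges
    \<open>v\<close> and \<open>0\<close>, so the differences \<open>v - w\<close> run through the
    nonzero elements.\<close>
  have D: "(\<Prod>w\<in>V - {v}. v - w) = D" if "v \<in> V" for v
  proof -
    have "0 \<in> V" using diff[OF that that] by simp
    have "v - u \<in> V \<longleftrightarrow> u \<in> V" for u
      using diff[OF that, of u] diff[OF that, of "v - u"] by auto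
    thus ?thesis unfolding D_def
      by (intro prod.reindex_bij_witness[of _ "\<lambda>u. v - u" "\<lambda>u. v - u"]) auto
  qed
  \<comment> \<open>A zero factor of \<open>P\<close> would put \<open>- x\<close> in
    \<open>V\<close>, against \<open>nz\<close>.\<close>
  have "D \<noteq> 0" "P \<noteq> 0"
    using assms(1) nz[of "- x"] by (auto simp: D_def P_def)
  have "(\<Sum>v\<in>V. poly g v / (x + v)) = - D / P * poly g (- x)"
    if "Polynomial.degree g < card V" for g
  proof -
    have "(\<Prod>w\<in>V - {v}. (- x - w) / (v - w)) = - P / D / (x + v)" if "v \<in> V" for v
    proof -
      have "P = (- x - v) * (\<Prod>w\<in>V - {v}. - x - w)"
        unfolding P_def by (rule prod.remove) (use that assms in auto)
      also have "- x - v = - (x + v)" by simp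
      finally have "P = - ((x + v) * (\<Prod>w\<in>V - {v}. - x - w))"
        by (simp only: mult_minus_left)
      hence "(\<Prod>w\<in>V - {v}. - x - w) = - P / (x + v)"
        using nz[OF that] by simp
      thus ?thesis by (simp add: prod_dividef D[OF that])
    qed
    hence "poly g (- x) = (\<Sum>v\<in>V. poly g v * (- P / D / (x + v)))"
      using lagrange_interpolation[OF assms(1) that, of "- x"] by simp
    also have "\<dots> = - P / D * (\<Sum>v\<in>V. poly g v / (x + v))"
      by (simp add: sum_distrib_left sum_negf mult_ac)
    finally show ?thesis using \<open>D \<noteq> 0\<close> \<open>P \<noteq> 0\<close> by (simp add: field_simps)
  qed
  thus ?thesis by blast
qed

section \<open>Arithmetic in a finite subfield\<close>

locale finite_subfield =
  fixes K :: "'a :: field set"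
  assumes subfield: "subfield K (ring_of_type_algebra :: 'a ring)"
    and primepow_card: "primepow (card K)"
begin

lemma finite_K [simp]: "finite K"
  using primepow_card by (intro card_ge_0_finite primepow_gt_0_nat)

lemma card_K_gt_1: "card K > 1"
  using primepow_card primepow_gt_Suc_0 by auto

lemma
  shows zero_in_K [simp]: "0 \<in> K" and one_in_K [simp]: "1 \<in> K"
    and add_in_K [simp]: "x \<in> K \<Longrightarrow> y \<in> K \<Longrightarrow> x + y \<in> K"
    and mult_in_K [simp]: "x \<in> K \<Longrightarrow> y \<in> K \<Longrightarrow> x * y \<in> K"
proof -
  have "subring K (ring_of_type_algebra :: 'a ring)"
    using subfieldE(1)[OF subfield] .
  note subringE[OF this]
  thus "0 \<in> K" "1 \<in> K" "x \<in> K \<Longrightarrow> y \<in> K \<Longrightarrow> x + y \<in> K"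
    "x \<in> K \<Longrightarrow> y \<in> K \<Longrightarrow> x * y \<in> K"
    by (auto simp: ring_of_type_algebra_def)
qed

lemma uminus_in_K [simp]: "x \<in> K \<Longrightarrow> - x \<in> K"
proof -
  assume "x \<in> K"
  \<comment> \<open>An injective self-map of a finite set is onto, so translation by
    \<open>x\<close> hits 0.\<close>
  hence "(+) x ` K = K" by (intro endo_inj_surj) auto
  then obtain y where "y \<in> K" "x + y = 0" using zero_in_K by (metis imageE)
  thus "- x \<in> K" by (metis minus_unique)
qed

lemma diff_in_K [simp]: "x \<in> K \<Longrightarrow> y \<in> K \<Longrightarrow> x - y \<in> K"
  using add_in_K[of x "- y"] by simp

lemma bij_betw_mult_K:
  assumes "a \<in> K" "a \<noteq> 0"
  shows "bij_betw ((*) a) K K"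
proof -
  have "inj_on ((*) a) K" using assms by (auto intro: inj_onI)
  moreover have "(*) a ` K \<subseteq> K" using assms by auto
  ultimately show ?thesis
    by (simp add: bij_betw_def endo_inj_surj)
qed

lemma inverse_in_K [simp]: "x \<in> K \<Longrightarrow> inverse x \<in> K"
proof (cases "x = 0")
  case False
  assume "x \<in> K"
  then obtain y where "y \<in> K" "x * y = 1"
    using bij_betw_mult_K[OF _ False] one_in_K by (metis bij_betw_def imageE)
  thus ?thesis by (metis inverse_unique)
qed auto

text \<open>Fermat's argument: multiplication by a nonzero \<open>a\<close> permutes
  \<open>K - {0}\<close>, and the product of these elements cancels.\<close>

lemma power_card_K:
  assumes "a \<in> K"
  shows "a ^ card K = a"
proof (cases "a = 0")
  case False
  have "\<Prod>(K - {0}) = (\<Prod>x\<in>K - {0}. a * x)"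
    by (rule prod.reindex_bij_betw[symmetric])
       (use bij_betw_DiffI[OF bij_betw_mult_K[OF assms False], of "{0}" "{0}"] in simp)
  also have "\<dots> = a ^ (card K - 1) * \<Prod>(K - {0})"
    by (simp add: prod.distrib)
  finally have "a ^ (card K - 1) = 1" by simp
  thus ?thesis using card_K_gt_1 by (metis power_minus_mult mult_1 not_one_less_zero gr0I)
qed (use card_K_gt_1 in simp)

text \<open>Translation by 1 permutes \<open>K\<close> and adds \<open>card K\<close> to the sum of
  its elements.\<close>

lemma of_nat_card_K [simp]: "of_nat (card K) = (0 :: 'a)"
proof -
  have "(\<Sum>x\<in>K. x) = (\<Sum>x\<in>K. x + 1)"
    by (rule sum.reindex_bij_witness[of _ "\<lambda>x. x + 1" "\<lambda>x. x - 1"]) auto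
  thus ?thesis by (simp add: sum.distrib)
qed

text \<open>A third element \<open>a\<close> exists; scaling by it permutes \<open>K\<close>, so the
  sum equals \<open>a\<close> times itself with \<open>a \<noteq> 1\<close>.\<close>

lemma sum_K_eq_0:
  assumes "card K > 2"
  shows "(\<Sum>t\<in>K. t) = 0"
proof -
  have "card (K - {0, 1}) > 0"
    using assms by (subst card_Diff_subset) auto
  then obtain a where a: "a \<in> K" "a \<noteq> 0" "a \<noteq> 1"
    by (metis DiffE card_gt_0_iff ex_in_conv insertCI)
  have "(\<Sum>t\<in>K. t) = a * (\<Sum>t\<in>K. t)"
    using sum.reindex_bij_betw[OF bij_betw_mult_K[OF a(1,2)], of "\<lambda>t. t"]
    by (simp add: sum_distrib_left)
  thus ?thesis using a by simp
qed

section \<open>The Frobenius power and additive polynomials\<close>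

lemma card_K_eq_CHAR_power: "\<exists>n. card K = CHAR('a) ^ n" and prime_CHAR: "Factorial_Ring.prime CHAR('a)"
proof -
  obtain p n where pn: "Factorial_Ring.prime p" "card K = p ^ n"
    using primepow_card by (auto simp: primepow_def)
  \<comment> \<open>Since \<open>card K\<close> is 0 in the field, the characteristic divides
    \<open>p ^ n\<close>; it is thus positive, hence prime, hence \<open>p\<close>.\<close>
  have dvd: "CHAR('a) dvd p ^ n"
    using of_nat_card_K pn of_nat_eq_0_iff_char_dvd by metis
  hence "CHAR('a) > 0" using pn by (auto intro: gr0I)
  thus "Factorial_Ring.prime CHAR('a)" by (rule prime_CHAR_semidom)
  with dvd pn(1) have "CHAR('a) = p"
    by (metis prime_dvd_power primes_dvd_imp_eq)
  thus "\<exists>n. card K = CHAR('a) ^ n" using pn by blast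
qed

lemma power_card_K_add: "(x + y :: 'a) ^ card K = x ^ card K + y ^ card K"
  using card_K_eq_CHAR_power freshmans_dream'[OF prime_CHAR] by metis

text \<open>The step of the induction replaces \<open>p\<close> by \<open>p\<^sup>q - p(b)\<^sup>q\<^sup>-\<^sup>1 p\<close>,
  which is again additive and homogeneous over \<open>K\<close>, and also kills the new vector \<open>b\<close>.\<close>

lemma annihilator_poly:
  assumes "finite I"
  shows "\<exists>p. Polynomial.degree p = card K ^ card I \<and>
           (\<forall>x y. poly p (x + y) = poly p x + poly p y) \<and>
           (\<forall>c\<in>K. \<forall>x. poly p (c * x) = c * poly p x) \<and>
           (\<forall>i\<in>I. poly p (b i) = 0)"
  using assms
proof (induction I)
  case empty
  show ?case by (rule exI[of _ "[:0, 1:]"]) auto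
next
  case (insert i I)
  then obtain p where deg: "Polynomial.degree p = card K ^ card I"
    and add: "\<And>x y. poly p (x + y) = poly p x + poly p y"
    and hom: "\<And>c x. c \<in> K \<Longrightarrow> poly p (c * x) = c * poly p x"
    and zero: "\<And>i. i \<in> I \<Longrightarrow> poly p (b i) = 0"
    by blast
  define c where "c = poly p (b i) ^ (card K - 1)"
  define r where "r = p ^ card K + Polynomial.smult (- c) p"
  have pos: "card K ^ card I > 0" using card_K_gt_1 by simp
  hence "p \<noteq> 0" using deg by auto
  have "Polynomial.degree (p ^ card K) = card K ^ card (insert i I)"
    using insert.hyps \<open>p \<noteq> 0\<close> deg by (simp add: degree_power_eq)
  moreover have "Polynomial.degree (Polynomial.smult (- c) p) < card K ^ card (insert i I)"
    using insert.hyps deg card_K_gt_1 pos by (intro le_less_trans[OF degree_smult_le]) simp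
  ultimately have "Polynomial.degree r = card K ^ card (insert i I)"
    unfolding r_def by (metis degree_add_eq_left)
  moreover have "poly r (x + y) = poly r x + poly r y" for x y
    by (simp add: r_def add power_card_K_add algebra_simps)
  \<comment> \<open>Elements of \<open>K\<close> are fixed by the power \<open>card K\<close>, so
    raising to it preserves homogeneity over \<open>K\<close>.\<close>
  moreover have "poly r (k * x) = k * poly r x" if "k \<in> K" for k x
    using that by (simp add: r_def hom power_mult_distrib power_card_K algebra_simps)
  moreover have "poly r (b j) = 0" if "j \<in> insert i I" for j
  proof (cases "j = i")
    case True
    have "c * poly p (b i) = poly p (b i) ^ card K"
      unfolding c_def by (rule power_minus_mult) (use card_K_gt_1 in simp)
    thus ?thesis using True by (simp add: r_def)
  next
    case False
    thus ?thesis using that zero card_K_gt_1 by (simp add: r_def)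
  qed
  ultimately show ?case by blast
qed

section \<open>Linear combinations of the \<open>b i\<close>, independent and dependent\<close>

abbreviation comb :: "'i set \<Rightarrow> ('i \<Rightarrow> 'a) \<Rightarrow> ('i \<Rightarrow> 'a) \<Rightarrow> 'a" where
  "comb I b \<theta> \<equiv> \<Sum>i\<in>I. \<theta> i * b i"

lemma card_PiE_K: "finite I \<Longrightarrow> card (I \<rightarrow>\<^sub>E K) = card K ^ card I"
  by (simp add: card_PiE)

text \<open>The annihilator of the other vectors sees only the \<open>i\<close>-th term of a
  combination; dividing by its value at \<open>b i\<close> leaves the coordinate.\<close>

lemma coordinate_poly:
  assumes "finite I" "i \<in> I" and inj: "inj_on (comb I b) (I \<rightarrow>\<^sub>E K)"
  shows "\<exists>p. Polynomial.degree p \<le> card K ^ (card I - 1) \<and>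
           (\<forall>\<theta>\<in>I \<rightarrow>\<^sub>E K. poly p (comb I b \<theta>) = \<theta> i)"
proof -
  obtain p where deg: "Polynomial.degree p = card K ^ card (I - {i})"
    and add: "\<And>x y. poly p (x + y) = poly p x + poly p y"
    and hom: "\<And>c x. c \<in> K \<Longrightarrow> poly p (c * x) = c * poly p x"
    and zero: "\<And>j. j \<in> I - {i} \<Longrightarrow> poly p (b j) = 0"
    using annihilator_poly[of "I - {i}" b] assms by blast
  have poly_0: "poly p 0 = 0" using hom[of 0 0] by simp
  have poly_sum_p: "poly p (sum f A) = (\<Sum>j\<in>A. poly p (f j))" for f :: "'b \<Rightarrow> 'a" and A
    by (induction A rule: infinite_finite_induct) (auto simp: add poly_0)
  have eval: "poly p (comb I b \<theta>) = \<theta> i * poly p (b i)" if "\<theta> \<in> I \<rightarrow>\<^sub>E K" for \<theta>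
  proof -
    have "poly p (comb I b \<theta>) = (\<Sum>j\<in>I. \<theta> j * poly p (b j))"
      unfolding poly_sum_p using that by (intro sum.cong refl hom) (rule PiE_mem)
    also have "\<dots> = \<theta> i * poly p (b i)"
      using assms zero by (subst sum.remove[of _ i]) auto
    finally show ?thesis .
  qed
  \<comment> \<open>Otherwise \<open>p\<close> would vanish on the whole span, which has more points
    than the degree of \<open>p\<close>.\<close>
  have nz: "poly p (b i) \<noteq> 0"
  proof
    assume "poly p (b i) = 0"
    hence sub: "comb I b ` (I \<rightarrow>\<^sub>E K) \<subseteq> {x. poly p x = 0}" using eval by auto
    have "p \<noteq> 0" using deg card_K_gt_1 by auto
    have "card K ^ card I = card (comb I b ` (I \<rightarrow>\<^sub>E K))"
      using assms by (simp add: card_image card_PiE_K)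
    also have "\<dots> \<le> card {x. poly p x = 0}"
      by (rule card_mono[OF poly_roots_finite[OF \<open>p \<noteq> 0\<close>] sub])
    also have "\<dots> \<le> card K ^ card (I - {i})"
      using card_poly_roots_bound[OF \<open>p \<noteq> 0\<close>] deg by simp
    also have "\<dots> < card K ^ card I"
      using card_K_gt_1 assms by (intro power_strict_increasing card_Diff1_less)
    finally show False by simp
  qed
  show ?thesis
    by (rule exI[of _ "Polynomial.smult (inverse (poly p (b i))) p"])
       (use assms nz eval deg in \<open>auto simp: field_simps\<close>)
qed

lemma affine_poly:
  assumes "finite I" and inj: "inj_on (comb I b) (I \<rightarrow>\<^sub>E K)"
  shows "\<exists>g. Polynomial.degree g \<le> card K ^ (card I - 1) \<and>
           (\<forall>\<theta>\<in>I \<rightarrow>\<^sub>E K. poly g (comb I b \<theta>) = m + comb I a \<theta>)"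
proof -
  obtain p where deg: "\<And>i. i \<in> I \<Longrightarrow> Polynomial.degree (p i) \<le> card K ^ (card I - 1)"
    and p: "\<And>i \<theta>. i \<in> I \<Longrightarrow> \<theta> \<in> I \<rightarrow>\<^sub>E K \<Longrightarrow> poly (p i) (comb I b \<theta>) = \<theta> i"
    using coordinate_poly[OF assms(1) _ inj] by metis
  define g where "g = [:m:] + (\<Sum>i\<in>I. Polynomial.smult (a i) (p i))"
  have "Polynomial.degree g \<le> card K ^ (card I - 1)"
    unfolding g_def using assms(1) deg
    by (intro degree_add_le degree_sum_le) (auto intro: order_trans[OF degree_smult_le])
  moreover have "poly g (comb I b \<theta>) = m + comb I a \<theta>" if "\<theta> \<in> I \<rightarrow>\<^sub>E K" for \<theta>
    using p[OF _ that] by (simp add: g_def poly_sum mult.commute)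
  ultimately show ?thesis by blast
qed

text \<open>Injectivity turns the sum over tuples into a sum over the span, an additive subgroup
  with \<open>card K ^ card I\<close> elements.\<close>

lemma independent_partial_fraction:
  assumes "finite I" and inj: "inj_on (comb I b) (I \<rightarrow>\<^sub>E K)"
    and nz: "\<And>\<theta>. \<theta> \<in> I \<rightarrow>\<^sub>E K \<Longrightarrow> x + comb I b \<theta> \<noteq> 0"
  shows "\<exists>C. \<forall>g. Polynomial.degree g < card K ^ card I \<longrightarrow>
           (\<Sum>\<theta>\<in>I \<rightarrow>\<^sub>E K. poly g (comb I b \<theta>) / (x + comb I b \<theta>)) = C * poly g (- x)"
proof -
  define V where "V = comb I b ` (I \<rightarrow>\<^sub>E K)"
  have "finite V" using assms(1) by (simp add: V_def finite_PiE)
  have "card V = card K ^ card I" using assms by (simp add: V_def card_image card_PiE_K)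
  have "v - w \<in> V" if vw: "v \<in> V" "w \<in> V" for v w
  proof -
    obtain \<theta> \<eta> where *: "\<theta> \<in> I \<rightarrow>\<^sub>E K" "\<eta> \<in> I \<rightarrow>\<^sub>E K" "v = comb I b \<theta>" "w = comb I b \<eta>"
      using vw by (auto simp: V_def)
    have "v - w = comb I b (\<lambda>i\<in>I. \<theta> i - \<eta> i)"
      by (simp add: * algebra_simps flip: sum_subtractf)
    moreover have "(\<lambda>i\<in>I. \<theta> i - \<eta> i) \<in> I \<rightarrow>\<^sub>E K" using * by (auto simp: PiE_iff)
    ultimately show ?thesis unfolding V_def by blast
  qed
  moreover have "x + v \<noteq> 0" if "v \<in> V" for v using that nz by (auto simp: V_def)
  ultimately obtain C where
    C: "\<And>g. Polynomial.degree g < card V \<Longrightarrow> (\<Sum>v\<in>V. poly g v / (x + v)) = C * poly g (- x)"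
    using partial_fraction_additive_subgroup[OF \<open>finite V\<close>, of x] by blast
  thus ?thesis
    unfolding \<open>card V = card K ^ card I\<close> by (simp add: V_def sum.reindex[OF inj]) blast
qed

text \<open>If \<open>b\<close> is dependent, the denominators are constant along lines in the direction of a
  relation, and an affine function sums to \<open>0\<close> over each such line.\<close>

lemma dependent_sum_eq_0:
  assumes "finite I" and ninj: "\<not> inj_on (comb I b) (I \<rightarrow>\<^sub>E K)" and "card K > 2"
  shows "(\<Sum>\<theta>\<in>I \<rightarrow>\<^sub>E K. (m + comb I a \<theta>) / (x + comb I b \<theta>)) = 0"
proof -
  obtain \<theta> \<eta> where *: "\<theta> \<in> I \<rightarrow>\<^sub>E K" "\<eta> \<in> I \<rightarrow>\<^sub>E K" "comb I b \<theta> = comb I b \<eta>" "\<theta> \<noteq> \<eta>"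
    using ninj by (auto simp: inj_on_def)
  obtain k where k: "k \<in> I" "\<theta> k \<noteq> \<eta> k"
    using *(4) PiE_ext[OF *(1,2)] by blast
  \<comment> \<open>A relation among the \<open>b i\<close>, scaled so that \<open>c k = 1\<close>:
    the \<open>k\<close>-th coordinate then parametrises the lines in direction
    \<open>c\<close>.\<close>
  define c where "c i = (\<theta> i - \<eta> i) / (\<theta> k - \<eta> k)" for i
  have c: "c i \<in> K" if "i \<in> I" for i
    unfolding c_def divide_inverse
    using PiE_mem[OF *(1)] PiE_mem[OF *(2)] k(1) that by simp
  have "c k = 1" using k by (simp add: c_def)
  have "comb I b c = (comb I b \<theta> - comb I b \<eta>) / (\<theta> k - \<eta> k)"
    by (simp add: c_def sum_divide_distrib left_diff_distrib diff_divide_distrib sum_subtractf)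
  hence rel: "comb I b c = 0" using * by simp
  define J where "J = I - {k}"
  have J: "I = insert k J" "k \<notin> J" "finite J" using k assms(1) by (auto simp: J_def)
  \<comment> \<open>The point with parameter \<open>t\<close> on the line whose base point is
    \<open>\<theta>\<close> with its \<open>k\<close>-th coordinate set to 0.\<close>
  define shift where "shift t \<theta> = (\<lambda>i\<in>I. (if i = k then 0 else \<theta> i) + t * c i)"
    for t and \<theta> :: "'b \<Rightarrow> 'a"
  have comb_shift: "comb I h (shift t \<theta>) = comb J h \<theta> + t * comb I h c" for h t \<theta>
  proof -
    have "comb I h (shift t \<theta>) = (\<Sum>i\<in>I. (if i = k then 0 else \<theta> i) * h i) + t * comb I h c"
      by (simp add: shift_def sum_distrib_left algebra_simps flip: sum.distrib)
    also have "(\<Sum>i\<in>I. (if i = k then 0 else \<theta> i) * h i) = comb J h \<theta>"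
      unfolding J(1) using J(2,3) by (simp add: sum.insert) (auto intro!: sum.cong)
    finally show ?thesis .
  qed
  \<comment> \<open>Each tuple lies on exactly one line: its parameter is \<open>\<theta> k\<close>,
    and subtracting \<open>\<theta> k * c i\<close> recovers the base point.\<close>
  have "(\<Sum>\<theta>\<in>I \<rightarrow>\<^sub>E K. (m + comb I a \<theta>) / (x + comb I b \<theta>)) =
        (\<Sum>(\<theta>, t)\<in>(J \<rightarrow>\<^sub>E K) \<times> K.
           (m + comb I a (shift t \<theta>)) / (x + comb I b (shift t \<theta>)))"
  proof (rule sum.reindex_bij_witness[of _ "\<lambda>(\<theta>, t). shift t \<theta>"
        "\<lambda>\<theta>. (\<lambda>i\<in>J. \<theta> i - \<theta> k * c i, \<theta> k)"], goal_cases)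
    case (1 \<theta>)
    thus ?case using J \<open>c k = 1\<close>
      by (auto simp: shift_def fun_eq_iff PiE_def extensional_def)
  next
    case (2 \<theta>)
    thus ?case using J c by (auto simp: PiE_iff)
  next
    case (3 y)
    thus ?case using J \<open>c k = 1\<close>
      by (auto simp: shift_def fun_eq_iff PiE_def extensional_def split: prod.splits)
  next
    case (4 y)
    thus ?case using J c by (auto simp: shift_def PiE_iff split: prod.splits)
  next
    case (5 \<theta>)
    have "shift (\<theta> k) (\<lambda>i\<in>J. \<theta> i - \<theta> k * c i) = \<theta>"
      using 5 J \<open>c k = 1\<close> by (auto simp: shift_def fun_eq_iff PiE_def extensional_def)
    thus ?case by simp
  qed
  also have "\<dots> = (\<Sum>\<theta>\<in>J \<rightarrow>\<^sub>E K. \<Sum>t\<in>K.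
      (m + comb J a \<theta>) / (x + comb J b \<theta>) + t * (comb I a c / (x + comb J b \<theta>)))"
    by (simp add: comb_shift rel sum.cartesian_product add_divide_distrib add.assoc)
  \<comment> \<open>On each line the constant part is summed \<open>card K\<close> times, giving 0
    in the field, and the linear part is a multiple of the sum over \<open>K\<close>.\<close>
  also have "\<dots> = 0"
    by (simp add: sum.distrib sum_K_eq_0[OF assms(3)] del: times_divide_eq_right
        flip: sum_distrib_right)
  finally show ?thesis .
qed

section \<open>The product formula from the two cases\<close>

lemma prod_sum_affine_fractions:
  assumes "finite I" "I \<noteq> {}" "finite J" "J \<noteq> {}" "card J < card K"
    and nz: "\<And>\<theta>. \<theta> \<in> I \<rightarrow>\<^sub>E K \<Longrightarrow> x + comb I b \<theta> \<noteq> 0"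
  shows "(\<Prod>j\<in>J. \<Sum>\<theta>\<in>I \<rightarrow>\<^sub>E K. (m j + comb I (a j) \<theta>) / (x + comb I b \<theta>)) =
     (\<Sum>\<theta>\<in>I \<rightarrow>\<^sub>E K. 1 / (x + comb I b \<theta>)) ^ (card J - 1) *
     (\<Sum>\<theta>\<in>I \<rightarrow>\<^sub>E K. (\<Prod>j\<in>J. m j + comb I (a j) \<theta>) / (x + comb I b \<theta>))"
proof (cases "inj_on (comb I b) (I \<rightarrow>\<^sub>E K)")
  case True
  obtain C where C: "\<And>g. Polynomial.degree g < card K ^ card I \<Longrightarrow>
      (\<Sum>\<theta>\<in>I \<rightarrow>\<^sub>E K. poly g (comb I b \<theta>) / (x + comb I b \<theta>)) = C * poly g (- x)"
    using independent_partial_fraction[OF assms(1) True nz] by blast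
  have "\<forall>j. \<exists>g. Polynomial.degree g \<le> card K ^ (card I - 1) \<and>
      (\<forall>\<theta>\<in>I \<rightarrow>\<^sub>E K. poly g (comb I b \<theta>) = m j + comb I (a j) \<theta>)"
    using affine_poly[OF assms(1) True] by blast
  from choice[OF this] obtain g where deg: "\<And>j. Polynomial.degree (g j) \<le> card K ^ (card I - 1)"
    and g: "\<And>j \<theta>. \<theta> \<in> I \<rightarrow>\<^sub>E K \<Longrightarrow> poly (g j) (comb I b \<theta>) = m j + comb I (a j) \<theta>"
    by blast
  have pos: "card K ^ (card I - 1) > 0" using card_K_gt_1 by simp
  have card_I: "card K ^ card I = card K * card K ^ (card I - 1)"
    using assms(1,2) by (metis card_gt_0_iff power_eq_if not_gr_zero)
  have "(\<Sum>\<theta>\<in>I \<rightarrow>\<^sub>E K. (m j + comb I (a j) \<theta>) / (x + comb I b \<theta>)) = C * poly (g j) (- x)" for j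
  proof -
    have "Polynomial.degree (g j) < card K ^ card I"
      using le_less_trans[OF deg[of j]] pos card_K_gt_1 unfolding card_I by simp
    from C[OF this] show ?thesis by (simp add: g)
  qed
  \<comment> \<open>The constant polynomial 1 identifies \<open>C\<close> as the sum of
    reciprocals.\<close>
  moreover have "(\<Sum>\<theta>\<in>I \<rightarrow>\<^sub>E K. 1 / (x + comb I b \<theta>)) = C"
    using C[of 1] card_K_gt_1 by simp
  moreover have "(\<Sum>\<theta>\<in>I \<rightarrow>\<^sub>E K. (\<Prod>j\<in>J. m j + comb I (a j) \<theta>) / (x + comb I b \<theta>)) =
      C * (\<Prod>j\<in>J. poly (g j) (- x))"
  proof -
    \<comment> \<open>This is where \<open>card J < card K\<close> enters: the degree is at most
      \<open>card J * card K ^ (card I - 1)\<close>.\<close>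
    have "Polynomial.degree (prod g J) \<le> (\<Sum>j\<in>J. card K ^ (card I - 1))"
      using assms(3) deg by (intro order_trans[OF degree_prod_sum_le] sum_mono) simp_all
    also have "\<dots> < card K ^ card I"
      using assms(5) pos by (simp add: card_I)
    finally show ?thesis using C[of "prod g J"] by (simp add: g poly_prod)
  qed
  moreover have "C ^ card J = C ^ (card J - 1) * C"
    by (subst power_minus_mult) (use assms(3,4) in \<open>simp_all add: card_gt_0_iff\<close>)
  ultimately show ?thesis by (simp add: prod.distrib)
next
  case False
  show ?thesis
  \<comment> \<open>For a single factor the exponent \<open>card J - 1\<close> is 0 and both sides
    coincide; this covers \<open>card K = 2\<close>, where the vanishing lemma does not
    apply.\<close>
  proof (cases "card J = 1")
    case True
    then obtain j where "J = {j}" by (auto simp: card_1_singleton_iff)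
    thus ?thesis by simp
  next
    case card_J: False
    have "card J > 0" using assms(3,4) by (simp add: card_gt_0_iff)
    hence "card J > 1" "card K > 2" using card_J assms(5) by linarith+
    note zero = dependent_sum_eq_0[OF assms(1) False \<open>card K > 2\<close>]
    \<comment> \<open>The reciprocals are the case of constant numerator 1; their sum occurs on the
      right with positive exponent.\<close>
    have "(\<Sum>\<theta>\<in>I \<rightarrow>\<^sub>E K. 1 / (x + comb I b \<theta>)) = 0"
      using zero[of 1 "\<lambda>_. 0" x] by simp
    thus ?thesis using \<open>card J > 1\<close> assms(3,4) by (simp add: zero zero_power)
  qed
qed

end

theorem theorem5:
  fixes q d s :: nat
    and K :: "'a :: field set"
    and \<mu> :: 'a
    and b M :: "nat \<Rightarrow> 'a"
    and B :: "nat \<Rightarrow> nat \<Rightarrow> 'a"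
  assumes "primepow q"
    and "subfield K (ring_of_type_algebra :: 'a ring)" and "card K = q"
    and "d \<ge> 1" and "1 \<le> s" and "s < q"
    and "\<forall>\<theta> \<in> {1..d} \<rightarrow>\<^sub>E K. \<mu> + (\<Sum>i=1..d. \<theta> i * b i) \<noteq> 0"
  shows "(\<Prod>j=1..s. \<Sum>\<theta> \<in> {1..d} \<rightarrow>\<^sub>E K.
            (M j + (\<Sum>i=1..d. \<theta> i * B i j)) / (\<mu> + (\<Sum>i=1..d. \<theta> i * b i)))
       = (\<Sum>\<theta> \<in> {1..d} \<rightarrow>\<^sub>E K. 1 / (\<mu> + (\<Sum>i=1..d. \<theta> i * b i))) ^ (s - 1)
         * (\<Sum>\<theta> \<in> {1..d} \<rightarrow>\<^sub>E K.
              (\<Prod>j=1..s. M j + (\<Sum>i=1..d. \<theta> i * B i j)) / (\<mu> + (\<Sum>i=1..d. \<theta> i * b i)))"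
proof -
  interpret finite_subfield K
    by (rule finite_subfield.intro) (simp_all add: assms)
  show ?thesis
    using prod_sum_affine_fractions[of "{1..d}" "{1..s}" \<mu> b M "\<lambda>j i. B i j"] assms by simp
qed

end
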